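(* Let $G$ be a directed graph rooted in a vertex $r$, in which all vertices have indegree at most two. Then the two bipartition classes of the (bipartite) flip graph $\mathcal{F}_r(G)$ differ in size by at most $1$; that is, if the vertex set of $\mathcal{F}_r(G)$ is partitioned into two independent sets $X$ and $Y$, then $\bigl||X|-|Y|\bigr|\le 1$.
   Context: Directed graphs are finite, without loops and without parallel arcs (arcs in opposite directions between two vertices are allowed). An arborescence of $G$ rooted in $r$ is a spanning tree of $G$ in which all arcs are oriented away from $r$. Two arborescences differ by an arc flip if they are equal on all arcs but one. The flip graph $\mathcal{F}_r(G)$ is the undirected graph whose vertices are the arborescences of $G$ rooted in $r$, two of them being adjacent if they differ by an arc flip. When all vertices of $G$ have indegree at most two, $\mathcal{F}_r(G)$ is bipartite. Flip graphs are connected, so the bipartition is unique up to exchanging the two classes (classes may be empty). *)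

theory Defs
  imports "Graph_Theory.Digraph_Component"
begin

text \<open>
  The predicates \<^const>\<open>forest\<close>, \<^const>\<open>tree\<close> and \<^const>\<open>spanning_tree\<close> of the library are not
  usable for oriented graphs: they only exclude directed cycles, so for instance the digraph with
  arcs \<open>ab\<close>, \<open>bc\<close>, \<open>ac\<close> would be a tree. We therefore exclude the cycles of the underlying undirected
  multigraph. Its walks are the walks of the following digraph, where \<open>(e, True)\<close> is the arc \<open>e\<close>
  traversed from tail to head and \<open>(e, False)\<close> is the same arc traversed from head to tail.
\<close>

definition two_way :: "('a, 'b) pre_digraph \<Rightarrow> ('a, 'b \<times> bool) pre_digraph" where
  "two_way H =
    \<lparr> verts = verts H,
      arcs = arcs H \<times> UNIV,
      tail = (\<lambda>(e, fwd). if fwd then tail H e else head H e),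
      head = (\<lambda>(e, fwd). if fwd then head H e else tail H e) \<rparr>"

text \<open>
  Distinctness of the underlying arcs rules out traversing one arc back and forth, while
  two opposite arcs \<open>uv\<close>, \<open>vu\<close> do form a cycle of length two.
\<close>

definition undirected_cycle :: "('a, 'b) pre_digraph \<Rightarrow> ('b \<times> bool) list \<Rightarrow> bool" where
  "undirected_cycle H p \<longleftrightarrow> pre_digraph.cycle (two_way H) p \<and> distinct (map fst p)"

definition undirected_tree :: "('a, 'b) pre_digraph \<Rightarrow> bool" where
  "undirected_tree H \<longleftrightarrow> connected H \<and> (\<nexists>p. undirected_cycle H p)"

text \<open>
  In a tree there is exactly one undirected path from \<open>r\<close> to the head of \<open>e\<close>; the arc \<open>e\<close> points
  away from \<open>r\<close> iff this path ends with \<open>e\<close>, traversed forwards.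
\<close>

definition oriented_away :: "('a, 'b) pre_digraph \<Rightarrow> 'a \<Rightarrow> 'b \<Rightarrow> bool" where
  "oriented_away H r e \<longleftrightarrow> (\<exists>p. pre_digraph.apath (two_way H) r (p @ [(e, True)]) (head H e))"

definition arborescence :: "('a, 'b) pre_digraph \<Rightarrow> 'a \<Rightarrow> ('a, 'b) pre_digraph \<Rightarrow> bool" where
  "arborescence G r T \<longleftrightarrow>
    spanning T G \<and> undirected_tree T \<and> r \<in> verts T \<and> (\<forall>e\<in>arcs T. oriented_away T r e)"

definition arc_flip :: "('a, 'b) pre_digraph \<Rightarrow> ('a, 'b) pre_digraph \<Rightarrow> bool" where
  "arc_flip T T' \<longleftrightarrow> card (arcs T - arcs T') = 1 \<and> card (arcs T' - arcs T) = 1"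

text \<open>As usual in the library, an undirected graph is a digraph with a symmetric arc relation.\<close>

definition flip_graph :: "('a, 'b) pre_digraph \<Rightarrow> 'a \<Rightarrow> ('a, 'b) pre_digraph pair_pre_digraph" where
  "flip_graph G r =
    \<lparr> pverts = {T. arborescence G r T},
      parcs = {(T, T'). arborescence G r T \<and> arborescence G r T' \<and> arc_flip T T'} \<rparr>"

definition independent_set :: "'v pair_pre_digraph \<Rightarrow> 'v set \<Rightarrow> bool" where
  "independent_set F S \<longleftrightarrow> S \<subseteq> pverts F \<and> (\<forall>u\<in>S. \<forall>v\<in>S. (u, v) \<notin> parcs F)"

definition bipartition :: "'v pair_pre_digraph \<Rightarrow> 'v set \<Rightarrow> 'v set \<Rightarrow> bool" where
  "bipartition F X Y \<longleftrightarrow>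
    X \<union> Y = pverts F \<and> X \<inter> Y = {} \<and> independent_set F X \<and> independent_set F Y"

end

theory Submission
  imports Defs "Jordan_Normal_Form.Determinant"
begin

text \<open>
  An arborescence is a choice of one in-arc for every vertex other than the root, subject to
  acyclicity. Give the two in-arcs of a vertex opposite signs, and let the sign of an arborescence be
  the product of the signs of its arcs. By the weighted matrix tree theorem, the sum of these signs is
  the determinant of the reduced Laplacian. As the two signs at a vertex cancel on the diagonal, every
  row of this matrix has at most one entry 1 and at most one entry -1, all others being 0; such a
  determinant is -1, 0 or 1. A flip exchanges the two in-arcs of one vertex and hence changes the
  sign. Since the flip graph is connected, every bipartition is the partition by sign.
\<close>

section \<open>Determinants\<close>

lemma det_mat:
  "det (mat n n (\<lambda>(i, j). f i j)) =
    (\<Sum>p | p permutes {0..<n}. signof p * (\<Prod>i=0..<n. f i (p i)))"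
  unfolding det_def using permutes_in_image[of _ "{0..<n}"]
  by (fastforce intro!: sum.cong prod.cong arg_cong[where f = "\<lambda>x. _ * x"])

text \<open>Multilinearity in the rows. With \<open>E i\<close> the in-arcs of the i-th vertex, the
  determinant of the Laplacian becomes a sum over choices of one in-arc per vertex.\<close>

lemma det_row_sum:
  fixes f :: "nat \<Rightarrow> 'e \<Rightarrow> nat \<Rightarrow> 'a :: comm_ring_1"
  assumes "\<And>i. i < n \<Longrightarrow> finite (E i)"
  shows "det (mat n n (\<lambda>(i, j). \<Sum>e\<in>E i. f i e j)) =
    (\<Sum>c\<in>PiE {0..<n} E. det (mat n n (\<lambda>(i, j). f i (c i) j)))"
proof -
  have "det (mat n n (\<lambda>(i, j). \<Sum>e\<in>E i. f i e j)) =
      (\<Sum>p | p permutes {0..<n}. \<Sum>c\<in>PiE {0..<n} E.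
      signof p * (\<Prod>i=0..<n. f i (c i) (p i)))"
    unfolding det_mat using assms by (subst prod_sum_PiE) (auto simp: sum_distrib_left)
  also have "\<dots> = (\<Sum>c\<in>PiE {0..<n} E. \<Sum>p | p permutes {0..<n}.
      signof p * (\<Prod>i=0..<n. f i (c i) (p i)))"
    by (rule sum.swap)
  finally show ?thesis unfolding det_mat .
qed

lemma det_scale_rows:
  "det (mat n n (\<lambda>(i, j). w i * f i j)) = (\<Prod>i=0..<n. w i) * det (mat n n (\<lambda>(i, j). f i j))"
  unfolding det_mat by (simp add: prod.distrib sum_distrib_left mult_ac)

lemma det_eq_0_if_kernel:
  fixes f :: "nat \<Rightarrow> nat \<Rightarrow> 'a :: idom"
  assumes "\<And>i. i < n \<Longrightarrow> (\<Sum>j=0..<n. f i j * x j) = 0" and "k < n" "x k \<noteq> 0"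
  shows "det (mat n n (\<lambda>(i, j). f i j)) = 0"
proof -
  let ?A = "mat n n (\<lambda>(i, j). f i j)"
  have "?A *\<^sub>v vec n x = 0\<^sub>v n"
    using assms(1) by (intro eq_vecI) (auto simp: scalar_prod_def)
  moreover have "vec n x \<noteq> 0\<^sub>v n"
    using assms(2,3) by (metis index_vec index_zero_vec(1))
  ultimately show ?thesis
    by (subst det_0_iff_vec_prod_zero[of _ n]) (auto intro!: exI[of _ "vec n x"])
qed

text \<open>Induction on \<open>n\<close>. The last hypothesis leaves at most one 1 and at most one
  -1 in each row. A row with at most one nonzero entry is used for Laplace expansion, and the minor
  inherits the hypotheses. If there is no such row, every row consists of one 1, one -1 and zeros,
  so the all-ones vector lies in the kernel.\<close>

lemma abs_det_network_matrix_le_1: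
  fixes A :: "int mat"
  assumes "A \<in> carrier_mat n n"
    and "\<And>i j. i < n \<Longrightarrow> j < n \<Longrightarrow> A $$ (i, j) \<in> {-1, 0, 1}"
    and "\<And>i j k. i < n \<Longrightarrow> j < n \<Longrightarrow> k < n \<Longrightarrow> j \<noteq> k \<Longrightarrow> A $$ (i, j) \<noteq> 0 \<Longrightarrow> A $$ (i, j) \<noteq> A $$ (i, k)"
  shows "\<bar>det A\<bar> \<le> 1"
  using assms
proof (induction n arbitrary: A)
  case 0
  then show ?case by simp
next
  case (Suc n)
  note A = Suc.prems
  show ?case
  proof (cases "\<exists>i<Suc n. \<exists>j<Suc n. \<forall>k<Suc n. k \<noteq> j \<longrightarrow> A $$ (i, k) = 0")
    case True
    then obtain i j where i: "i < Suc n" and j: "j < Suc n"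
      and z: "\<And>k. k < Suc n \<Longrightarrow> k \<noteq> j \<Longrightarrow> A $$ (i, k) = 0" by blast
    have M: "mat_delete A i j \<in> carrier_mat n n"
      using mat_delete_carrier[OF A(1), of i j] by simp
    \<comment> \<open>The index shift is injective, so distinct columns of the minor come from
      distinct columns of \<open>A\<close>.\<close>
    have ent: "mat_delete A i j $$ (a, b) =
        A $$ (if a < i then a else Suc a, if b < j then b else Suc b)" if "a < n" "b < n" for a b
      using that A(1) by (simp add: mat_delete_def)
    have "\<bar>det (mat_delete A i j)\<bar> \<le> 1"
    proof (rule Suc.IH[OF M])
      fix a b assume "a < n" "b < n"
      then show "mat_delete A i j $$ (a, b) \<in> {-1, 0, 1}"
        unfolding ent[OF \<open>a < n\<close> \<open>b < n\<close>] by (intro A(2)) auto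
    next
      fix a b c assume *: "a < n" "b < n" "c < n" "b \<noteq> c" "mat_delete A i j $$ (a, b) \<noteq> 0"
      from *(5) show "mat_delete A i j $$ (a, b) \<noteq> mat_delete A i j $$ (a, c)"
        unfolding ent[OF *(1,2)] ent[OF *(1,3)] using *(1-4) by (intro A(3)) auto
    qed
    moreover have "det A = A $$ (i, j) * cofactor A i j"
    proof -
      have "det A = (\<Sum>k<Suc n. A $$ (i, k) * cofactor A i k)"
        by (rule laplace_expansion_row[OF A(1) i])
      also have "\<dots> = (\<Sum>k\<in>{j}. A $$ (i, k) * cofactor A i k)"
        using j z by (intro sum.mono_neutral_right) auto
      finally show ?thesis by simp
    qed
    moreover have "\<bar>A $$ (i, j)\<bar> \<le> 1" using A(2)[OF i j] by auto
    ultimately show ?thesis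
      by (simp add: cofactor_def abs_mult power_abs mult_le_one)
  next
    case False
    have "(\<Sum>j=0..<Suc n. A $$ (i, j)) = 0" if i: "i < Suc n" for i
    proof -
      \<comment> \<open>The negated case condition, taken at any column, gives a nonzero entry;
        taken at the column of that entry, it gives a second one.\<close>
      obtain k where k: "k < Suc n" "A $$ (i, k) \<noteq> 0" using False i by blast
      then obtain l where l: "l < Suc n" "l \<noteq> k" "A $$ (i, l) \<noteq> 0" using False i by blast
      have opp: "A $$ (i, k) + A $$ (i, l) = 0"
        using A(2)[OF i k(1)] A(2)[OF i l(1)] A(3)[OF i k(1) l(1)] k l by auto
      have "A $$ (i, m) = 0" if "m < Suc n" "m \<noteq> k" "m \<noteq> l" for m
        using A(2)[OF i that(1)] A(2)[OF i k(1)] A(2)[OF i l(1)] A(3)[OF i k(1) that(1)]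
          A(3)[OF i l(1) that(1)] A(3)[OF i k(1) l(1)] that k l by auto
      then have "(\<Sum>j=0..<Suc n. A $$ (i, j)) = (\<Sum>j\<in>{k, l}. A $$ (i, j))"
        using k l by (intro sum.mono_neutral_right) auto
      then show ?thesis using l opp by simp
    qed
    then have "det (mat (Suc n) (Suc n) (\<lambda>(i, j). A $$ (i, j))) = 0"
      by (intro det_eq_0_if_kernel[where x = "\<lambda>_. 1" and k = 0]) auto
    moreover have "mat (Suc n) (Suc n) (\<lambda>(i, j). A $$ (i, j)) = A"
      using A(1) by (intro eq_matI) auto
    ultimately show ?thesis by simp
  qed
qed

section \<open>Closed walks in the underlying undirected graph\<close>

lemma not_distinct_map_decomp:
  "\<not> distinct (map f p) \<Longrightarrow> \<exists>xs s ys t zs. p = xs @ s # ys @ t # zs \<and> f s = f t"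
proof (induction p)
  case (Cons a p)
  show ?case
  proof (cases "distinct (map f p)")
    case True
    then obtain t where "t \<in> set p" "f a = f t" using Cons.prems by auto
    moreover from this obtain ys zs where "p = ys @ t # zs" by (meson split_list)
    ultimately show ?thesis by (metis append_Nil)
  next
    case False
    then show ?thesis using Cons.IH by (metis append_Cons)
  qed
qed simp

definition reversed_step :: "'b \<times> bool \<Rightarrow> 'b \<times> bool" where
  "reversed_step s = (fst s, \<not> snd s)"

text \<open>Walks without backtracking. Unlike being a path, this is a local condition: when two
  reduced walks are concatenated, only the seam has to be checked.\<close>

definition reduced :: "('b \<times> bool) list \<Rightarrow> bool" where
  "reduced = successively (\<lambda>s t. t \<noteq> reversed_step s)"

lemma two_way_sel [simp]:
  "verts (two_way H) = verts H"
  "s \<in> arcs (two_way H) \<longleftrightarrow> fst s \<in> arcs H"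
  "tail (two_way H) (e, True) = tail H e" "tail (two_way H) (e, False) = head H e"
  "head (two_way H) (e, True) = head H e" "head (two_way H) (e, False) = tail H e"
  by (auto simp: two_way_def mem_Times_iff)

lemma two_way_ends:
  "tail (two_way H) s = (if snd s then tail H (fst s) else head H (fst s))"
  "head (two_way H) s = (if snd s then head H (fst s) else tail H (fst s))"
  by (auto simp: two_way_def split: prod.splits)

lemma two_way_reversed_step [simp]:
  "tail (two_way H) (reversed_step s) = head (two_way H) s"
  "head (two_way H) (reversed_step s) = tail (two_way H) s"
  "fst (reversed_step s) = fst s"
  by (auto simp: two_way_def reversed_step_def split: prod.splits)

lemma reduced_rev: "reduced (rev (map reversed_step p)) \<longleftrightarrow> reduced p"
  unfolding reduced_def
  by (auto simp: successively_map reversed_step_def prod_eq_iff elim!: successively_mono)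

locale two_way_digraph = wf_digraph H for H :: "('a, 'b) pre_digraph"
begin

sublocale D: wf_digraph "two_way H"
  by standard (auto simp: two_way_def)

lemma awalk_rev:
  "D.awalk u p v \<Longrightarrow> D.awalk v (rev (map reversed_step p)) u"
proof (induction p arbitrary: u)
  case Nil
  then show ?case by (auto simp: D.awalk_Nil_iff)
next
  case (Cons s p)
  then have "D.awalk v (rev (map reversed_step p)) (head (two_way H) s)"
    and "fst s \<in> arcs H" "u = tail (two_way H) s"
    by (auto simp: D.awalk_Cons_iff)
  moreover from this have "D.awalk (head (two_way H) s) [reversed_step s] u"
    by (auto simp: D.awalk_Cons_iff D.awalk_Nil_iff simp del: two_way_sel(1) dest: D.tail_in_verts)
  ultimately show ?case by (simp only: list.map rev.simps) (rule D.awalk_appendI)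
qed

text \<open>Going back along an arc returns to the vertex where its traversal began, so that vertex
  would occur twice.\<close>

lemma apath_imp_reduced: "D.apath u p v \<Longrightarrow> reduced p"
proof (induction p arbitrary: u rule: induct_list012)
  case (3 s t p)
  have "tail (two_way H) s \<noteq> head (two_way H) t"
    using 3(3) D.hd_in_awalk_verts by (fastforce simp: D.apath_Cons_iff)
  then have "t \<noteq> reversed_step s" by auto
  moreover have "reduced (t # p)"
    using 3 by (auto simp: D.apath_Cons_iff)
  ultimately show ?case by (simp add: reduced_def)
qed (simp_all add: reduced_def)

text \<open>Induction on the length. If two steps end at the same vertex, the part after the first
  one up to and including the second is a shorter closed reduced walk. Otherwise the walk itself is
  a cycle, once its arcs are shown to be distinct.\<close>

lemma undirected_cycle_if_closed_reduced:
  "D.awalk u p u \<Longrightarrow> p \<noteq> [] \<Longrightarrow> reduced p \<Longrightarrow> \<exists>q. undirected_cycle H q"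
proof (induction "length p" arbitrary: p u rule: less_induct)
  case less
  have heads: "tl (D.awalk_verts u p) = map (head (two_way H)) p"
    using less.prems D.awalk_verts_conv'[of u p u] by auto
  show ?case
  proof (cases "distinct (map (head (two_way H)) p)")
    case True
    have "distinct (map fst p)"
    proof (rule ccontr)
      assume "\<not> distinct (map fst p)"
      then obtain xs s ys t zs where p: "p = xs @ s # ys @ t # zs" and st: "fst s = fst t"
        using not_distinct_map_decomp by blast
      have "s \<noteq> t" using True p by auto
      \<comment> \<open>A repeated arc must be used in both directions. The step just before
        \<open>t\<close> then ends where \<open>s\<close> ends, so it is \<open>s\<close> itself as
        heads are distinct; but \<open>s\<close> followed by its reversal is backtracking.\<close>
      then have rs: "t = reversed_step s" using st by (auto simp: reversed_step_def prod_eq_iff)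
      show False
      proof (cases ys rule: rev_cases)
        case Nil
        then show False using less.prems(3) p rs
          by (simp add: reduced_def successively_append_iff)
      next
        case (snoc ys' c)
        then have "head (two_way H) c = tail (two_way H) t"
          using less.prems(1) p by (auto simp: D.awalk_Cons_iff D.awlast_append D.awalk_verts_conv)
        then show False using True p snoc rs by auto
      qed
    qed
    then show ?thesis using less.prems heads True
      unfolding undirected_cycle_def D.cycle_def by metis
  next
    case False
    then obtain xs s ys t zs where p: "p = xs @ s # ys @ t # zs"
        and st: "head (two_way H) s = head (two_way H) t"
      using not_distinct_map_decomp by blast
    have "D.awalk (head (two_way H) s) (ys @ [t]) (head (two_way H) s)"
      using less.prems(1) p st
      by (auto simp: D.awalk_Cons_iff D.awalk_Nil_iff dest: D.awalk_hd_in_verts)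
    moreover have "reduced (ys @ [t])"
      using less.prems(3) p by (auto simp: reduced_def successively_append_iff successively_Cons)
    ultimately show ?thesis
      using p by (intro less.hyps[of "ys @ [t]" "head (two_way H) s"]) auto
  qed
qed

lemma awalk_forwards: "awalk u p v \<Longrightarrow> D.awalk u (map (\<lambda>e. (e, True)) p) v"
  by (induction p arbitrary: u) (auto simp: awalk_Nil_iff awalk_Cons_iff D.awalk_Nil_iff D.awalk_Cons_iff)

lemma awalk_forwardsD: "D.awalk u p v \<Longrightarrow> \<forall>s\<in>set p. snd s \<Longrightarrow> awalk u (map fst p) v"
  by (induction p arbitrary: u) (auto simp: awalk_Nil_iff awalk_Cons_iff D.awalk_Nil_iff D.awalk_Cons_iff)

lemma awalk_verts_forwards:
  "D.awalk_verts u (map (\<lambda>e. (e, True)) p) = awalk_verts u p"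
  by (induction p arbitrary: u) auto

lemma reduced_forwards: "reduced (map (\<lambda>e. (e, True)) p)"
  by (induction p rule: induct_list012) (auto simp: reduced_def reversed_step_def)

lemma acyclic_if_no_undirected_cycle:
  assumes "\<nexists>q. undirected_cycle H q"
  shows "acyclic (arcs_ends H)"
proof (rule acyclicI, intro allI notI)
  fix v assume "(v, v) \<in> (arcs_ends H)\<^sup>+"
  then obtain p where "awalk v p v" "p \<noteq> []" by (auto simp: reachable1_awalk)
  then show False
    using undirected_cycle_if_closed_reduced[OF awalk_forwards _ reduced_forwards] assms by auto
qed

lemma head_neq_if_oriented_away: "oriented_away H r e \<Longrightarrow> head H e \<noteq> r"
  unfolding oriented_away_def using D.apath_nonempty_ends by blast

text \<open>
  Two distinct arcs with the same head would give two paths from \<open>r\<close> to that vertex, and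
  following one path and then the other one backwards is a reduced closed walk.
\<close>

lemma eq_if_oriented_away:
  assumes "\<nexists>q. undirected_cycle H q"
    and "oriented_away H r e" "oriented_away H r e'" "head H e = head H e'"
  shows "e = e'"
proof (rule ccontr)
  assume "e \<noteq> e'"
  obtain p p' where p: "D.apath r (p @ [(e, True)]) (head H e)"
    and p': "D.apath r (p' @ [(e', True)]) (head H e)"
    using assms(2-4) by (auto simp: oriented_away_def)
  let ?q = "(p @ [(e, True)]) @ rev (map reversed_step (p' @ [(e', True)]))"
  have "reduced (p @ [(e, True)])" "reduced (rev (map reversed_step (p' @ [(e', True)])))"
    using p p' apath_imp_reduced unfolding reduced_rev by blast+
  then have "reduced ?q"
    using \<open>e \<noteq> e'\<close> unfolding reduced_def
    by (subst successively_append_iff) (auto simp: reversed_step_def)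
  moreover have "D.awalk r ?q r"
    using p p' by (intro D.awalk_appendI[OF _ awalk_rev]) (auto dest: D.awalkI_apath)
  ultimately show False using undirected_cycle_if_closed_reduced assms(1) by blast
qed

text \<open>Take an undirected path from \<open>r\<close> to \<open>v\<close>. If its last arc
  \<open>e\<close> were traversed backwards, the path without \<open>e\<close>, followed by the
  reversal of the path witnessing that \<open>e\<close> points away from \<open>r\<close>, would be
  a closed reduced walk.\<close>

lemma in_arc_if_oriented_away:
  assumes tree: "undirected_tree H" and away: "\<forall>e\<in>arcs H. oriented_away H r e"
    and "r \<in> verts H" "v \<in> verts H" "v \<noteq> r"
  shows "\<exists>e\<in>arcs H. head H e = v"
proof (rule ccontr)
  assume none: "\<not> ?thesis"
  have "r \<rightarrow>\<^sup>*\<^bsub>mk_symmetric H\<^esub> v"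
    using assms unfolding undirected_tree_def connected_def strongly_connected_def by simp
  \<comment> \<open>Connectedness is defined through the symmetric closure, which forgets the names
    of arcs; reachability there is the same as in \<open>two_way H\<close>.\<close>
  moreover have "arcs_ends (with_proj (mk_symmetric H)) = arcs_ends (two_way H)"
    by (auto simp: parcs_mk_symmetric arcs_ends_conv two_way_def image_iff) (metis (full_types))+
  ultimately have "r \<rightarrow>\<^sup>*\<^bsub>two_way H\<^esub> v" by (simp add: reachable_def)
  then obtain q where q: "D.apath r q v" by (auto simp: D.reachable_apath)
  then have "q \<noteq> []" using \<open>v \<noteq> r\<close> by (auto simp: D.apath_Nil_iff)
  then obtain q' e b where qs: "q = q' @ [(e, b)]" by (metis rev_exhaust surj_pair)
  have e: "e \<in> arcs H" "head (two_way H) (e, b) = v"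
    using q qs by (auto dest!: D.awalkI_apath simp: D.awalk_simps)
  then have b: "b = False" "tail H e = v" using none by (cases b, auto)+
  obtain p where p: "D.apath r (p @ [(e, True)]) (head H e)"
    using away e by (auto simp: oriented_away_def)
  let ?q = "q' @ rev (map reversed_step (p @ [(e, True)]))"
  have rp: "rev (map reversed_step (p @ [(e, True)])) = (e, False) # rev (map reversed_step p)"
    by (simp add: reversed_step_def)
  \<comment> \<open>The closed walk is covered by these two reduced walks, which overlap in the step
    \<open>(e, False)\<close>; hence no seam is left to check.\<close>
  have "reduced (q' @ [(e, False)])" "reduced ((e, False) # rev (map reversed_step p))"
    using apath_imp_reduced[OF q] apath_imp_reduced[OF p] qs b reduced_rev[of "p @ [(e, True)]"]
    unfolding rp by auto
  then have "reduced ?q"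
    unfolding rp reduced_def by (auto simp: successively_append_iff)
  moreover have "D.awalk r ?q r"
    using q qs b
    by (intro D.awalk_appendI[OF _ awalk_rev[OF D.awalkI_apath[OF p]]])
      (auto dest!: D.awalkI_apath simp: D.awalk_simps)
  moreover have "?q \<noteq> []" unfolding rp by simp
  ultimately show False
    using undirected_cycle_if_closed_reduced[of r ?q] tree
    unfolding undirected_tree_def by blast
qed

section \<open>Arborescences from acyclicity and unique in-arcs\<close>

lemma awalk_imp_apath_if_acyclic:
  assumes "acyclic (arcs_ends H)"
  shows "awalk u p v \<Longrightarrow> apath u p v"
proof (induction p arbitrary: u)
  case (Cons e p)
  then have e: "e \<in> arcs H" "u = tail H e" "awalk (head H e) p v"
    by (auto simp: awalk_Cons_iff)
  have "tail H e \<notin> set (awalk_verts (head H e) p)"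
  proof
    assume "tail H e \<in> set (awalk_verts (head H e) p)"
    then have "head H e \<rightarrow>\<^sup>*\<^bsub>H\<^esub> tail H e" using e awalk_verts_reachable_from by blast
    then have "(tail H e, tail H e) \<in> (arcs_ends H)\<^sup>+"
      using e(1) by (meson in_arcs_imp_in_arcs_ends reachable_rtranclI rtrancl_into_trancl2)
    then show False using assms by (auto simp: acyclic_def)
  qed
  then show ?case using e Cons.IH by (auto simp: apath_Cons_iff)
qed (auto simp: apath_Nil_iff awalk_Nil_iff)

text \<open>
  As heads are distinct, a walk without repeated arcs cannot turn from forwards to backwards. On a
  cycle it would have to begin backwards and end forwards, through the same arc.
\<close>

lemma no_undirected_cycle_if_unique_in_arcs:
  assumes acyclic: "acyclic (arcs_ends H)" and inj: "inj_on (head H) (arcs H)"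
  shows "\<not> undirected_cycle H p"
proof
  assume "undirected_cycle H p"
  then obtain u where u: "D.awalk u p u" "p \<noteq> []" "distinct (map fst p)"
    by (auto simp: undirected_cycle_def D.cycle_def)
  have no_closed: "q = []" if "awalk u q u" for q
    using that acyclic by (metis acyclic_def reachable1_awalk)
  have "successively (\<lambda>s t. snd s \<longrightarrow> snd t) p" if "D.awalk v p w" "distinct (map fst p)" for v w p
    using that
  proof (induction p arbitrary: v rule: induct_list012)
    case (3 s t p)
    have "snd t" if "snd s"
    proof (rule ccontr)
      assume "\<not> snd t"
      moreover have "head (two_way H) s = tail (two_way H) t" "fst s \<in> arcs H" "fst t \<in> arcs H"
        using 3(3) by (auto simp: D.awalk_Cons_iff)
      ultimately show False
        using that inj_onD[OF inj, of "fst s" "fst t"] 3(4) by (simp add: two_way_ends)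
    qed
    then show ?case using 3 by (auto simp: D.awalk_Cons_iff)
  qed simp_all
  then have mono: "sorted_wrt (\<lambda>s t. snd s \<longrightarrow> snd t) p"
    using u by (subst successively_iff_sorted_wrt_strong[symmetric]) auto
  obtain s q where p: "p = s # q" using u(2) by (cases p) auto
  have "\<not> snd s"
  proof
    assume "snd s"
    then have "awalk u (map fst p) u"
      using mono u p by (intro awalk_forwardsD) auto
    then show False using no_closed u(2) by blast
  qed
  have "snd (last p)"
  proof (rule ccontr)
    assume *: "\<not> snd (last p)"
    have "p = butlast p @ [last p]" using u(2) by simp
    then have "\<forall>t\<in>set p. \<not> snd t"
      using mono * by (metis (no_types, lifting) in_set_conv_decomp Un_iff set_append sorted_wrt_append empty_iff insert_iff list.set)
    then have "awalk u (map fst (rev (map reversed_step p))) u"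
      using awalk_rev[OF u(1)] by (intro awalk_forwardsD) (auto simp: reversed_step_def)
    then show False using no_closed u(2) by blast
  qed
  then have "q \<noteq> []" using \<open>\<not> snd s\<close> p by auto
  then obtain m t where q: "q = m @ [t]" by (metis rev_exhaust)
  have "snd t" using \<open>snd (last p)\<close> p q by simp
  have "D.awalk u ((s # m) @ [t]) u" using u(1) p q by simp
  then have "tail (two_way H) s = u" "head (two_way H) t = u" "fst s \<in> arcs H" "fst t \<in> arcs H"
    unfolding D.awalk_append_iff by (simp_all add: D.awalk_simps)
  then have "head H (fst s) = head H (fst t)"
    using \<open>snd t\<close> \<open>\<not> snd s\<close> by (simp add: two_way_ends)
  with \<open>fst s \<in> arcs H\<close> \<open>fst t \<in> arcs H\<close> show False using inj u(3) p q by (auto dest: inj_onD)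
qed

text \<open>A finite acyclic arc relation is well-founded, so going backwards along in-arcs must
  stop, and it can stop only at \<open>r\<close>.\<close>

lemma reachable_from_root_if_acyclic:
  assumes "finite (arcs H)" "acyclic (arcs_ends H)"
    and "r \<in> verts H" "\<And>v. v \<in> verts H \<Longrightarrow> v \<noteq> r \<Longrightarrow> \<exists>e\<in>arcs H. head H e = v"
  shows "v \<in> verts H \<Longrightarrow> r \<rightarrow>\<^sup>*\<^bsub>H\<^esub> v"
proof -
  have "wf (arcs_ends H)"
    using assms(1,2) by (intro finite_acyclic_wf) (auto simp: arcs_ends_conv)
  then show "v \<in> verts H \<Longrightarrow> r \<rightarrow>\<^sup>*\<^bsub>H\<^esub> v"
  proof (induction v)
    case (less v)
    show ?case
    proof (cases "v = r")
      case False
      then obtain e where "e \<in> arcs H" "head H e = v" using assms(4) less.prems by blast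
      then show ?thesis
        using less.IH[of "tail H e"] in_arcs_imp_in_arcs_ends[of e]
        by (auto intro: reachable_adj_trans)
    qed (use assms(3) in auto)
  qed
qed

lemma connected_if_reachable_from:
  assumes "r \<in> verts H" "\<And>v. v \<in> verts H \<Longrightarrow> r \<rightarrow>\<^sup>*\<^bsub>H\<^esub> v"
  shows "connected H"
proof -
  interpret S: pair_wf_digraph "mk_symmetric H" by (rule wellformed_mk_symmetric)
  have "r \<rightarrow>\<^sup>*\<^bsub>mk_symmetric H\<^esub> v" if "v \<in> verts H" for v
    using assms(2) that by (intro reachable_mk_symmetricI)
  then have "u \<rightarrow>\<^sup>*\<^bsub>mk_symmetric H\<^esub> v" if "u \<in> verts H" "v \<in> verts H" for u v
    using that symmetric_reachable[OF symmetric_mk_symmetric] S.reachable_trans by meson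
  then show ?thesis
    using assms(1) unfolding connected_def by (intro strongly_connectedI) auto
qed

lemma oriented_away_if_acyclic:
  assumes "acyclic (arcs_ends H)" "e \<in> arcs H" "r \<rightarrow>\<^sup>*\<^bsub>H\<^esub> tail H e"
  shows "oriented_away H r e"
proof -
  obtain p where "awalk r p (tail H e)" using assms(3) by (auto simp: reachable_awalk)
  then have "awalk r (p @ [e]) (head H e)"
    using assms(2) by (intro awalk_appendI) (auto simp: awalk_simps)
  then have "apath r (p @ [e]) (head H e)" by (rule awalk_imp_apath_if_acyclic[OF assms(1)])
  then have "D.apath r (map (\<lambda>e. (e, True)) (p @ [e])) (head H e)"
    using awalk_forwards by (simp only: apath_def D.apath_def awalk_verts_forwards)
  then show ?thesis unfolding oriented_away_def by auto
qed

end

text \<open>This replaces undirected paths and cycles by the form used from here on. The bijection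
  given by \<open>head G\<close> encodes exactly one in-arc for each vertex other than
  \<open>r\<close> and none for \<open>r\<close>; together with acyclicity this yields both
  connectedness and the absence of undirected cycles.\<close>

lemma arborescence_iff:
  fixes G T :: "('a, 'b) pre_digraph"
  assumes "digraph G" "r \<in> verts G"
  shows "arborescence G r T \<longleftrightarrow> spanning T G \<and> acyclic (arcs_ends T) \<and>
    bij_betw (head G) (arcs T) (verts G - {r})"
proof -
  interpret digraph G by fact
  show ?thesis
  proof (cases "spanning T G")
    case True
    then have sub: "verts T = verts G" "arcs T \<subseteq> arcs G" "wf_digraph T" "tail T = tail G" "head T = head G"
      by (auto simp: spanning_def subgraph_def compatible_def)
    interpret T: two_way_digraph T using sub(3) by (simp add: two_way_digraph_def)
    show ?thesis
    proof
      assume arb: "arborescence G r T"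
      then have tree: "undirected_tree T" and away: "\<forall>e\<in>arcs T. oriented_away T r e"
        and none: "\<nexists>q. undirected_cycle T q"
        by (auto simp: arborescence_def undirected_tree_def)
      have "inj_on (head G) (arcs T)"
        using T.eq_if_oriented_away[OF none] away sub(5) by (auto intro!: inj_onI)
      moreover have "head G ` arcs T = verts G - {r}"
      proof (intro equalityI subsetI)
        fix v assume "v \<in> verts G - {r}"
        then show "v \<in> head G ` arcs T"
          using T.in_arc_if_oriented_away[OF tree away, of v] sub assms(2) by auto
      next
        fix v assume "v \<in> head G ` arcs T"
        then obtain e where "e \<in> arcs T" "v = head T e" using sub(5) by auto
        then show "v \<in> verts G - {r}"
          using T.head_neq_if_oriented_away away T.head_in_verts sub(1) by auto
      qed
      ultimately show "spanning T G \<and> acyclic (arcs_ends T) \<and> bij_betw (head G) (arcs T) (verts G - {r})"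
        using True T.acyclic_if_no_undirected_cycle[OF none] by (simp add: bij_betw_def)
    next
      assume "spanning T G \<and> acyclic (arcs_ends T) \<and> bij_betw (head G) (arcs T) (verts G - {r})"
      then have acyc: "acyclic (arcs_ends T)" and inj: "inj_on (head T) (arcs T)"
        and im: "head T ` arcs T = verts T - {r}"
        using sub by (auto simp: bij_betw_def)
      have "finite (arcs T)" using sub(2) finite_arcs finite_subset by blast
      moreover have "\<exists>e\<in>arcs T. head T e = v" if "v \<in> verts T" "v \<noteq> r" for v
        using im that by (metis DiffI imageE singletonD)
      ultimately have reach: "r \<rightarrow>\<^sup>*\<^bsub>T\<^esub> v" if "v \<in> verts T" for v
        using T.reachable_from_root_if_acyclic[OF _ acyc _ _ that, of r] assms(2) sub(1) by blast
      then have "connected T" using T.connected_if_reachable_from assms(2) sub(1) by blast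
      moreover have "oriented_away T r e" if "e \<in> arcs T" for e
        using T.oriented_away_if_acyclic[OF acyc that] reach T.tail_in_verts[OF that] by blast
      ultimately show "arborescence G r T"
        unfolding arborescence_def undirected_tree_def
        using True assms(2) sub(1) T.no_undirected_cycle_if_unique_in_arcs[OF acyc inj] by blast
    qed
  qed (simp add: arborescence_def)
qed

section \<open>Signed enumeration of arborescences\<close>

text \<open>The rank of a vertex is its number of ancestors. Along an arc from \<open>u\<close> to
  \<open>v\<close> the ancestor set grows strictly, since \<open>u\<close> is an ancestor of
  \<open>v\<close> but, by acyclicity, not of itself.\<close>

lemma acyclic_rank:
  assumes "finite R" "acyclic R"
  obtains d :: "'a \<Rightarrow> nat" where "\<And>u v. (u, v) \<in> R \<Longrightarrow> d u < d v"
proof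
  fix u v assume uv: "(u, v) \<in> R"
  let ?anc = "\<lambda>v. {u. (u, v) \<in> R\<^sup>+}"
  have "?anc v \<subseteq> fst ` R\<^sup>+" by force
  then have "finite (?anc v)" using assms(1) finite_trancl finite_surj by blast
  moreover have "?anc u \<subset> ?anc v"
    using uv assms(2) by (auto simp: acyclic_def intro: trancl_into_trancl)
  ultimately show "card (?anc u) < card (?anc v)" by (rule psubset_card_mono)
qed

text \<open>The vertices other than the root are numbered by \<open>vs\<close>, so that they can index matrices.\<close>

locale rooted_indegree_two_digraph = digraph G for G :: "('a, 'b) pre_digraph" +
  fixes r :: 'a and n :: nat and vs :: "nat \<Rightarrow> 'a"
  assumes root: "r \<in> verts G"
    and vs: "bij_betw vs {0..<n} (verts G - {r})"
    and in_degree_le_2: "v \<in> verts G \<Longrightarrow> in_degree G v \<le> 2"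
begin

text \<open>\<open>PiE\<close> fixes the values outside \<open>{0..<n}\<close>, so a choice is
  determined by its set of arcs: the head of an arc reveals its index.\<close>

definition choices :: "(nat \<Rightarrow> 'b) set" where
  "choices = PiE {0..<n} (\<lambda>i. in_arcs G (vs i))"

definition tree_of :: "(nat \<Rightarrow> 'b) \<Rightarrow> ('a, 'b) pre_digraph" where
  "tree_of c = \<lparr>verts = verts G, arcs = c ` {0..<n}, tail = tail G, head = head G\<rparr>"

definition acyclic_choices :: "(nat \<Rightarrow> 'b) set" where
  "acyclic_choices = {c \<in> choices. acyclic (arcs_ends (tree_of c))}"

lemma vs_eq_iff: "i < n \<Longrightarrow> j < n \<Longrightarrow> vs i = vs j \<longleftrightarrow> i = j"
  using vs by (auto simp: bij_betw_def inj_on_def)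

lemma vs_in: "i < n \<Longrightarrow> vs i \<in> verts G" "i < n \<Longrightarrow> vs i \<noteq> r"
  using bij_betwE[OF vs] by auto

lemma choice_arc: "c \<in> choices \<Longrightarrow> i < n \<Longrightarrow> c i \<in> arcs G \<and> head G (c i) = vs i"
  by (auto simp: choices_def PiE_iff)

lemma choice_eqD: "c \<in> choices \<Longrightarrow> c' \<in> choices \<Longrightarrow> i < n \<Longrightarrow> j < n \<Longrightarrow> c i = c' j \<Longrightarrow> i = j"
  using choice_arc vs_eq_iff by metis

lemma arcs_ends_tree_of:
  "c \<in> choices \<Longrightarrow> arcs_ends (tree_of c) = (\<lambda>i. (tail G (c i), vs i)) ` {0..<n}"
  using choice_arc by (force simp: arcs_ends_conv tree_of_def)

lemma finite_choices: "finite choices"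
  unfolding choices_def by (intro finite_PiE) auto

text \<open>Turns sums over arborescences into sums over functions, which is the form produced by
  expanding the determinant.\<close>

lemma bij_betw_tree_of: "bij_betw tree_of acyclic_choices {T. arborescence G r T}"
proof (rule bij_betw_imageI)
  show "inj_on tree_of acyclic_choices"
  proof (rule inj_onI)
    fix c c' assume *: "c \<in> acyclic_choices" "c' \<in> acyclic_choices" "tree_of c = tree_of c'"
    from *(3) have "c ` {0..<n} = c' ` {0..<n}" by (simp add: tree_of_def)
    have "c i = c' i" if "i < n" for i
    proof -
      have "c i \<in> c' ` {0..<n}" using \<open>c ` {0..<n} = c' ` {0..<n}\<close> that by auto
      then obtain j where "j < n" "c i = c' j" by auto
      then show ?thesis using * that choice_eqD[of c c' i j] by (simp add: acyclic_choices_def)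
    qed
    then show "c = c'"
      using * unfolding acyclic_choices_def choices_def
      by (intro PiE_ext[of c "{0..<n}" _ c']) auto
  qed
  show "tree_of ` acyclic_choices = {T. arborescence G r T}"
  proof (intro equalityI subsetI)
    fix T assume "T \<in> tree_of ` acyclic_choices"
    then obtain c where c: "c \<in> choices" "acyclic (arcs_ends (tree_of c))" "T = tree_of c"
      by (auto simp: acyclic_choices_def)
    have "spanning T G"
      using c choice_arc vs_in(1) wf_digraph
      by (auto simp: spanning_def subgraph_def compatible_def tree_of_def wf_digraph_def)
    moreover have "bij_betw (head G) (arcs T) (verts G - {r})"
    proof (rule bij_betw_imageI)
      show "inj_on (head G) (arcs T)"
        using c choice_arc by (auto simp: tree_of_def inj_on_def vs_eq_iff)
      have "head G ` arcs T = vs ` {0..<n}"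
        using c choice_arc by (force simp: tree_of_def)
      then show "head G ` arcs T = verts G - {r}" using vs by (simp add: bij_betw_def)
    qed
    ultimately show "T \<in> {T. arborescence G r T}"
      using c arborescence_iff[OF digraph_axioms root] by simp
  next
    fix T assume "T \<in> {T. arborescence G r T}"
    then have T: "spanning T G" "acyclic (arcs_ends T)" "bij_betw (head G) (arcs T) (verts G - {r})"
      using arborescence_iff[OF digraph_axioms root] by auto
    \<comment> \<open>The inverse map: each index gets the arc of \<open>T\<close> that enters the
      corresponding vertex.\<close>
    define c where "c = restrict (inv_into (arcs T) (head G) \<circ> vs) {0..<n}"
    have "bij_betw (inv_into (arcs T) (head G) \<circ> vs) {0..<n} (arcs T)"
      using vs bij_betw_inv_into[OF T(3)] by (rule bij_betw_trans)
    then have arcs: "c ` {0..<n} = arcs T" by (simp add: c_def bij_betw_def)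
    then have "T = tree_of c"
      using T(1) by (auto simp: tree_of_def spanning_def subgraph_def compatible_def)
    moreover have "c i \<in> in_arcs G (vs i)" if "i < n" for i
    proof -
      have "c i \<in> arcs G"
        using that arcs T(1) by (force simp: spanning_def subgraph_def)
      moreover have "head G (c i) = vs i"
        using that T(3) vs_in by (simp add: c_def bij_betw_def f_inv_into_f)
      ultimately show ?thesis by simp
    qed
    then have "c \<in> choices" by (auto simp: choices_def c_def)
    ultimately show "T \<in> tree_of ` acyclic_choices"
      using T(2) by (auto simp: acyclic_choices_def)
  qed
qed

section \<open>The matrix tree theorem with signs\<close>

lemma choice_rank:
  assumes "c \<in> choices" "acyclic (arcs_ends (tree_of c))"
  obtains d :: "'a \<Rightarrow> nat" where "\<And>i. i < n \<Longrightarrow> d (tail G (c i)) < d (vs i)"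
proof -
  have "finite (arcs_ends (tree_of c))" by (simp add: arcs_ends_tree_of[OF assms(1)])
  then obtain d :: "'a \<Rightarrow> nat" where "\<And>u v. (u, v) \<in> arcs_ends (tree_of c) \<Longrightarrow> d u < d v"
    using acyclic_rank assms(2) by metis
  moreover have "(tail G (c i), vs i) \<in> arcs_ends (tree_of c)" if "i < n" for i
    using that by (auto simp: arcs_ends_tree_of[OF assms(1)])
  ultimately show ?thesis using that by blast
qed

text \<open>The contribution of an arc \<open>e\<close> into \<open>vs i\<close> to row
  \<open>i\<close> of the reduced Laplacian. The root has no column, so the -1 is missing if
  \<open>e\<close> leaves the root.\<close>

definition incidence :: "'b \<Rightarrow> nat \<Rightarrow> nat \<Rightarrow> int" where
  "incidence e i j = of_bool (j = i) - of_bool (vs j = tail G e)"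

text \<open>Only the identity contributes to the Leibniz formula. In a nonzero term every index that
  is moved goes to its parent, which lowers the rank \<open>d\<close>, whereas a permutation
  preserves the sum of all ranks.\<close>

lemma det_incidence_acyclic:
  assumes "c \<in> choices" "acyclic (arcs_ends (tree_of c))"
  shows "det (mat n n (\<lambda>(i, j). incidence (c i) i j)) = 1"
proof -
  obtain d :: "'a \<Rightarrow> nat" where d: "\<And>i. i < n \<Longrightarrow> d (tail G (c i)) < d (vs i)"
    using choice_rank assms by metis
  have "(\<Prod>i=0..<n. incidence (c i) i (p i)) = 0" if p: "p permutes {0..<n}" "p \<noteq> id" for p
  proof (rule ccontr)
    assume "\<not> ?thesis"
    then have "p i = i \<or> vs (p i) = tail G (c i)" if "i < n" for i
      using that by (auto simp: incidence_def of_bool_def split: if_splits)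
    then have le: "d (vs (p i)) < d (vs i) \<or> p i = i" if "i < n" for i
      using d that by metis
    obtain i where i: "p i \<noteq> i" using p(2) by (auto simp: fun_eq_iff)
    then have "i < n" using permutes_not_in[OF p(1), of i] by force
    then have "(\<Sum>i=0..<n. d (vs (p i))) < (\<Sum>i=0..<n. d (vs i))"
      using le i by (intro sum_strict_mono_ex1) (force simp: less_imp_le)+
    moreover have "(\<Sum>i=0..<n. d (vs (p i))) = (\<Sum>i=0..<n. d (vs i))"
      using sum.permute[OF p(1), of "d \<circ> vs"] by (simp add: o_def)
    ultimately show False by simp
  qed
  then have "det (mat n n (\<lambda>(i, j). incidence (c i) i j)) =
      (\<Sum>p\<in>{id}. signof p * (\<Prod>i=0..<n. incidence (c i) i (p i)))"
    unfolding det_mat by (intro sum.mono_neutral_right) (auto simp: permutes_id finite_permutations)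
  also have "\<dots> = 1"
  proof -
    have "vs i \<noteq> tail G (c i)" if "i < n" for i using d[OF that] by auto
    then show ?thesis by (simp add: incidence_def)
  qed
  finally show ?thesis .
qed

lemma det_incidence_not_acyclic:
  assumes c: "c \<in> choices" and "\<not> acyclic (arcs_ends (tree_of c))"
  shows "det (mat n n (\<lambda>(i, j). incidence (c i) i j)) = 0"
proof -
  let ?R = "arcs_ends (tree_of c)"
  note R = arcs_ends_tree_of[OF c]
  obtain v where v: "(v, v) \<in> ?R\<^sup>+" using assms(2) by (auto simp: acyclic_def)
  \<comment> \<open>Chosen arcs never enter the root, so every descendant has a column in the
    matrix.\<close>
  have range: "\<exists>k<n. y = vs k" if "(x, y) \<in> ?R\<^sup>+" for x y
    using that by (cases rule: trancl.cases) (auto simp: R)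
  \<comment> \<open>The descendants of a vertex on a cycle are closed under taking parents, so their indicator
    vector is in the kernel.\<close>
  define x :: "nat \<Rightarrow> int" where "x = (\<lambda>j. of_bool ((v, vs j) \<in> ?R\<^sup>+))"
  have "(\<Sum>j=0..<n. incidence (c i) i j * x j) = 0" if i: "i < n" for i
  proof -
    let ?t = "tail G (c i)"
    have arc: "(?t, vs i) \<in> ?R" using i by (auto simp: R)
    have "(v, vs i) \<in> ?R\<^sup>+ \<longleftrightarrow> (v, ?t) \<in> ?R\<^sup>+"
    proof
      assume "(v, vs i) \<in> ?R\<^sup>+"
      then obtain y where "(v, y) \<in> ?R\<^sup>*" "(y, vs i) \<in> ?R" by (meson tranclD2)
      \<comment> \<open>The parent of \<open>vs i\<close> is unique. If it is \<open>v\<close>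
        itself, it still counts as a descendant of \<open>v\<close> because \<open>v\<close> lies on
        a cycle.\<close>
      moreover from this have "y = ?t" using i by (auto simp: R vs_eq_iff)
      ultimately show "(v, ?t) \<in> ?R\<^sup>+" using v by (auto simp: rtrancl_eq_or_trancl)
    qed (use arc in \<open>auto intro: trancl_into_trancl\<close>)
    moreover have "(\<Sum>j=0..<n. of_bool (vs j = ?t) * x j) = of_bool ((v, ?t) \<in> ?R\<^sup>+)"
    proof (cases "\<exists>k<n. ?t = vs k")
      case True
      then obtain k where k: "k < n" "?t = vs k" by blast
      then have "(\<Sum>j=0..<n. of_bool (vs j = ?t) * x j) = (\<Sum>j=0..<n. if j = k then x k else 0)"
        by (intro sum.cong) (auto simp: vs_eq_iff)
      then show ?thesis using k by (simp add: x_def)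
    next
      case False
      then have "(v, ?t) \<notin> ?R\<^sup>+" using range by blast
      then show ?thesis using False by (force intro!: sum.neutral)
    qed
    moreover have "(\<Sum>j=0..<n. of_bool (j = i) * x j) = x i"
      using i by (simp add: of_bool_def if_distrib[of "\<lambda>b. b * _"] cong: if_cong)
    ultimately show ?thesis
      by (simp add: incidence_def left_diff_distrib sum_subtractf) (simp add: x_def)
  qed
  moreover obtain k where "k < n" "v = vs k" using range v by blast
  ultimately show ?thesis
    using v by (intro det_eq_0_if_kernel[of n _ x k]) (auto simp: x_def)
qed

text \<open>An arbitrary in-arc of each vertex is declared positive. The \<open>SOME\<close> term
  depends only on the head of \<open>e\<close>, so both in-arcs of a vertex are compared with the
  same arc.\<close>

definition arc_sign :: "'b \<Rightarrow> int" where
  "arc_sign e = (if e = (SOME e'. e' \<in> in_arcs G (head G e)) then 1 else -1)"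

definition choice_sign :: "(nat \<Rightarrow> 'b) \<Rightarrow> int" where
  "choice_sign c = (\<Prod>i=0..<n. arc_sign (c i))"

lemma arc_sign_cases: "arc_sign e = 1 \<or> arc_sign e = -1"
  by (simp add: arc_sign_def)

lemma in_arcs_eq:
  assumes "v \<in> verts G" "e \<in> in_arcs G v" "e' \<in> in_arcs G v" "e \<noteq> e'"
  shows "in_arcs G v = {e, e'}"
proof (rule sym, rule card_seteq)
  show "card (in_arcs G v) \<le> card {e, e'}"
    using in_degree_le_2[OF assms(1)] assms(4) by (simp add: in_degree_def)
qed (use assms in auto)

lemma arc_sign_other:
  assumes "v \<in> verts G" "e \<in> in_arcs G v" "e' \<in> in_arcs G v" "e \<noteq> e'"
  shows "arc_sign e' = - arc_sign e"
proof -
  have "(SOME a. a \<in> in_arcs G v) \<in> in_arcs G v" using assms(2) by (rule someI)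
  then have "(SOME a. a \<in> in_arcs G v) \<in> {e, e'}" using in_arcs_eq[OF assms] by blast
  moreover have "head G e = v" "head G e' = v" using assms by auto
  ultimately show ?thesis
    using assms(4) unfolding arc_sign_def by (auto simp del: in_in_arcs_conv)
qed

text \<open>With two in-arcs the diagonal terms cancel and the two tails remain, with opposite
  signs; with one in-arc the row is plus or minus an incidence row. A vanishing row is the case
  \<open>x = y\<close>, and an entry is also missing when \<open>x\<close> or \<open>y\<close> is
  the root.\<close>

lemma signed_row:
  assumes i: "i < n"
  shows "\<exists>s x y. (s = 1 \<or> s = -1) \<and> (\<forall>j<n. (\<Sum>e\<in>in_arcs G (vs i). arc_sign e * incidence e i j) =
    s * (of_bool (vs j = x) - of_bool (vs j = y)))"
    (is "\<exists>s x y. ?P s x y")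
proof (cases "in_arcs G (vs i) = {}")
  case True
  then have "?P 1 r r" by simp
  then show ?thesis by blast
next
  case False
  then obtain e where e: "e \<in> in_arcs G (vs i)" by blast
  show ?thesis
  proof (cases "in_arcs G (vs i) = {e}")
    case True
    then have "?P (arc_sign e) (vs i) (tail G e)"
      using arc_sign_cases[of e] by (simp add: incidence_def vs_eq_iff[OF _ i])
    then show ?thesis by blast
  next
    case False
    then obtain e' where e': "e' \<in> in_arcs G (vs i)" "e \<noteq> e'" using e by blast
    have "in_arcs G (vs i) = {e, e'}" "arc_sign e' = - arc_sign e"
      using in_arcs_eq arc_sign_other vs_in(1)[OF i] e e' by blast+
    then have "?P (arc_sign e) (tail G e') (tail G e)"
      using arc_sign_cases[of e] by (simp add: e'(2) incidence_def right_diff_distrib)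
    then show ?thesis by blast
  qed
qed

text \<open>Expanding the signed Laplacian by rows and pulling out the signs leaves one incidence
  determinant per choice, which is 1 for acyclic choices and 0 for all others.\<close>

lemma abs_sum_choice_sign_le_1: "\<bar>\<Sum>c\<in>acyclic_choices. choice_sign c\<bar> \<le> 1"
proof -
  let ?L = "mat n n (\<lambda>(i, j). \<Sum>e\<in>in_arcs G (vs i). arc_sign e * incidence e i j)"
  have "det ?L = (\<Sum>c\<in>choices. det (mat n n (\<lambda>(i, j). arc_sign (c i) * incidence (c i) i j)))"
    unfolding choices_def by (rule det_row_sum) auto
  also have "\<dots> = (\<Sum>c\<in>choices. choice_sign c * det (mat n n (\<lambda>(i, j). incidence (c i) i j)))"
    by (simp add: det_scale_rows choice_sign_def)
  also have "\<dots> = (\<Sum>c\<in>acyclic_choices. choice_sign c)"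
    using finite_choices det_incidence_acyclic det_incidence_not_acyclic
    by (intro sum.mono_neutral_cong_right) (auto simp: acyclic_choices_def)
  finally have "det ?L = (\<Sum>c\<in>acyclic_choices. choice_sign c)" .
  moreover have "\<bar>det ?L\<bar> \<le> 1"
  proof (rule abs_det_network_matrix_le_1)
    fix i j assume ij: "i < n" "j < n"
    obtain s :: int and x y :: 'a where s: "s = 1 \<or> s = -1" and L: "\<And>j. j < n \<Longrightarrow>
        (\<Sum>e\<in>in_arcs G (vs i). arc_sign e * incidence e i j) = s * (of_bool (vs j = x) - of_bool (vs j = y))"
      using signed_row[OF ij(1)] by blast
    have "?L $$ (i, j) = (\<Sum>e\<in>in_arcs G (vs i). arc_sign e * incidence e i j)"
      using ij by simp
    also note L[OF ij(2)]
    finally have "?L $$ (i, j) = s * (of_bool (vs j = x) - of_bool (vs j = y))" .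
    then show "?L $$ (i, j) \<in> {-1, 0, 1}" using s by (auto simp: of_bool_def)
  next
    fix i j k assume ijk: "i < n" "j < n" "k < n" "j \<noteq> k" and nz: "?L $$ (i, j) \<noteq> 0"
    obtain s :: int and x y :: 'a where s: "s = 1 \<or> s = -1" and L: "\<And>j. j < n \<Longrightarrow>
        (\<Sum>e\<in>in_arcs G (vs i). arc_sign e * incidence e i j) = s * (of_bool (vs j = x) - of_bool (vs j = y))"
      using signed_row[OF ijk(1)] by blast
    have row: "?L $$ (i, l) = s * (of_bool (vs l = x) - of_bool (vs l = y))" if "l < n" for l
      using L that ijk by simp
    have "vs j \<noteq> vs k" using ijk by (simp add: vs_eq_iff)
    \<comment> \<open>A nonzero entry at \<open>j\<close> means that exactly one of \<open>x\<close>
      and \<open>y\<close> is \<open>vs j\<close>; the same value at \<open>k\<close> would force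
      that vertex to be \<open>vs k\<close> as well.\<close>
    then show "?L $$ (i, j) \<noteq> ?L $$ (i, k)"
      using nz s unfolding row[OF ijk(2)] row[OF ijk(3)]
      by (auto simp: of_bool_def split: if_splits)
  qed simp
  ultimately show ?thesis by simp
qed

section \<open>Connectivity of the flip graph\<close>

text \<open>
  The flip is made at a vertex of least rank in \<open>c'\<close> among those where \<open>c\<close> and \<open>c'\<close> disagree: the
  ancestors of its new parent are the same in both, so no cycle arises.
\<close>

lemma flip_towards:
  assumes c: "c \<in> acyclic_choices" and c': "c' \<in> acyclic_choices" and "c \<noteq> c'"
  obtains i where "i < n" "c i \<noteq> c' i" "c(i := c' i) \<in> acyclic_choices"
proof -
  have ch: "c \<in> choices" "c' \<in> choices" and acyc: "acyclic (arcs_ends (tree_of c))"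
    using c c' by (auto simp: acyclic_choices_def)
  note R = arcs_ends_tree_of[OF ch(1)]
  obtain d :: "'a \<Rightarrow> nat" where d: "\<And>i. i < n \<Longrightarrow> d (tail G (c' i)) < d (vs i)"
    using choice_rank c' by (auto simp: acyclic_choices_def)
  obtain i0 where "i0 < n \<and> c i0 \<noteq> c' i0"
    using PiE_ext[OF ch[unfolded choices_def]] \<open>c \<noteq> c'\<close> by force
  then obtain i where i: "i < n" "c i \<noteq> c' i"
    and least: "\<And>j. j < n \<Longrightarrow> c j \<noteq> c' j \<Longrightarrow> d (vs i) \<le> d (vs j)"
    using ex_has_least_nat[of "\<lambda>i. i < n \<and> c i \<noteq> c' i" i0 "\<lambda>i. d (vs i)"] by blast
  let ?c = "c(i := c' i)" and ?u = "tail G (c' i)"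
  have cc: "?c \<in> choices" using ch i by (auto simp: choices_def PiE_iff extensional_def)
  have "d x \<le> d ?u" if "(x, ?u) \<in> (arcs_ends (tree_of c))\<^sup>*" for x
    using that
  proof (induction rule: converse_rtrancl_induct)
    case (step x y)
    then obtain j where j: "j < n" "x = tail G (c j)" "y = vs j" by (auto simp: R)
    then have "c j = c' j" using least[of j] step.IH d[OF i(1)] by fastforce
    then show ?case using d[OF j(1)] j step.IH by simp
  qed simp
  then have "(vs i, ?u) \<notin> (arcs_ends (tree_of c))\<^sup>*" using d[OF i(1)] by fastforce
  then have "acyclic (insert (?u, vs i) (arcs_ends (tree_of c)))" using acyc by simp
  moreover have "arcs_ends (tree_of ?c) \<subseteq> insert (?u, vs i) (arcs_ends (tree_of c))"
    unfolding R arcs_ends_tree_of[OF cc] by auto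
  ultimately have "?c \<in> acyclic_choices"
    using cc acyclic_subset by (auto simp: acyclic_choices_def)
  then show ?thesis using that i by blast
qed

lemma arc_flip_tree_of:
  assumes "c \<in> choices" "c(i := e) \<in> choices" "i < n" "c i \<noteq> e"
  shows "arc_flip (tree_of c) (tree_of (c(i := e)))"
proof -
  let ?I = "{0..<n} - {i}"
  \<comment> \<open>Arcs chosen at different indices have different heads, so neither the old nor
    the new arc occurs at another index.\<close>
  have "c i \<notin> c ` ?I" "e \<notin> c ` ?I"
    using choice_eqD[OF assms(1,1,3)] choice_eqD[OF assms(2,1,3)] by auto
  moreover have "c ` {0..<n} = insert (c i) (c ` ?I)" using assms(3) by auto
  moreover have "(c(i := e)) ` {0..<n} = insert e (c ` ?I)"
    using assms(3) by auto
  ultimately have "c ` {0..<n} - (c(i := e)) ` {0..<n} = {c i}"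
    "(c(i := e)) ` {0..<n} - c ` {0..<n} = {e}"
    using assms(4) by auto
  then show ?thesis by (simp add: arc_flip_def tree_of_def)
qed

section \<open>Comparing the bipartition with the signs\<close>

lemma choice_sign_flip:
  assumes "c \<in> choices" "c(i := e) \<in> choices" "i < n" "c i \<noteq> e"
  shows "choice_sign (c(i := e)) = - choice_sign c"
proof -
  have "arc_sign e = - arc_sign (c i)"
    using choice_arc[OF assms(1,3)] choice_arc[OF assms(2,3)] vs_in(1)[OF assms(3)] assms(4)
    by (intro arc_sign_other[of "vs i"]) auto
  moreover have "choice_sign f = arc_sign (f i) * (\<Prod>j\<in>{0..<n} - {i}. arc_sign (f j))" for f
    unfolding choice_sign_def using assms(3) by (intro prod.remove) auto
  ultimately show ?thesis by simp
qed

text \<open>A flip negates both factors, so their product is unchanged. By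
  \<open>flip_towards\<close>, flips lead from \<open>c\<close> to \<open>c'\<close> with one
  disagreement fewer each time. Thus \<open>f\<close> agrees with \<open>choice_sign\<close> up to a
  global factor.\<close>

lemma coloring_eq_choice_sign:
  fixes f :: "('a, 'b) pre_digraph \<Rightarrow> int"
  assumes f: "\<And>T T'. arborescence G r T \<Longrightarrow> arborescence G r T' \<Longrightarrow> arc_flip T T' \<Longrightarrow> f T' = - f T"
    and "c \<in> acyclic_choices" "c' \<in> acyclic_choices"
  shows "f (tree_of c) * choice_sign c = f (tree_of c') * choice_sign c'"
  using assms(2)
proof (induction "card {i. i < n \<and> c i \<noteq> c' i}" arbitrary: c rule: less_induct)
  case less
  show ?case
  proof (cases "c = c'")
    case False
    then obtain i where i: "i < n" "c i \<noteq> c' i" and c2: "c(i := c' i) \<in> acyclic_choices"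
      using flip_towards less.prems assms(3) by metis
    have "{j. j < n \<and> (c(i := c' i)) j \<noteq> c' j} \<subset> {j. j < n \<and> c j \<noteq> c' j}"
      using i by auto
    then have "f (tree_of (c(i := c' i))) * choice_sign (c(i := c' i)) = f (tree_of c') * choice_sign c'"
      using c2 by (intro less.hyps psubset_card_mono) auto
    moreover have ch: "c \<in> choices" "c(i := c' i) \<in> choices"
      using less.prems c2 by (auto simp: acyclic_choices_def)
    moreover have "f (tree_of (c(i := c' i))) = - f (tree_of c)"
      using less.prems c2 bij_betwE[OF bij_betw_tree_of] arc_flip_tree_of[OF ch i] by (intro f) auto
    ultimately show ?thesis using choice_sign_flip[OF ch i] by simp
  qed simp
qed

lemma bipartition_classes_differ_le_1:
  assumes "bipartition (flip_graph G r) X Y"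
  shows "\<bar>int (card X) - int (card Y)\<bar> \<le> 1"
proof -
  let ?A = "{T. arborescence G r T}"
  \<comment> \<open>Summing this colouring over all arborescences gives the difference of the class
    sizes.\<close>
  define f :: "('a, 'b) pre_digraph \<Rightarrow> int" where "f T = (if T \<in> X then 1 else -1)" for T
  have XY: "X \<union> Y = ?A" "X \<inter> Y = {}"
    and indep: "\<And>T T'. T \<in> X \<and> T' \<in> X \<or> T \<in> Y \<and> T' \<in> Y \<Longrightarrow> \<not> arc_flip T T'"
    using assms unfolding bipartition_def independent_set_def flip_graph_def by auto blast+
  have fin: "finite acyclic_choices" using finite_choices by (simp add: acyclic_choices_def)
  then have "finite ?A" using bij_betw_finite[OF bij_betw_tree_of] by simp
  then have "finite X" "finite Y" using XY(1) by (metis finite_Un)+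
  then have "(\<Sum>T\<in>?A. f T) = (\<Sum>T\<in>X. f T) + (\<Sum>T\<in>Y. f T)"
    using XY by (metis sum.union_disjoint)
  also have "(\<Sum>T\<in>X. f T) = int (card X)" by (simp add: f_def)
  also have "(\<Sum>T\<in>Y. f T) = (\<Sum>T\<in>Y. -1)" using XY(2) by (intro sum.cong) (auto simp: f_def)
  finally have diff: "(\<Sum>T\<in>?A. f T) = int (card X) - int (card Y)" by simp
  have flip: "f T' = - f T" if "arborescence G r T" "arborescence G r T'" "arc_flip T T'" for T T'
    using that XY(1) indep[of T T'] by (auto simp: f_def)
  show ?thesis
  proof (cases "acyclic_choices = {}")
    case True
    then have "?A = {}" using bij_betw_tree_of by (simp add: bij_betw_def)
    then show ?thesis using diff by simp
  next
    case False
    then obtain c0 where c0: "c0 \<in> acyclic_choices" by blast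
    \<comment> \<open>The global sign between the colouring and \<open>choice_sign\<close>, read off
      at an arbitrary reference choice.\<close>
    define k where "k = f (tree_of c0) * choice_sign c0"
    have unit: "choice_sign c = 1 \<or> choice_sign c = -1" for c
      unfolding choice_sign_def by (induction n) (use arc_sign_cases in force)+
    have "f (tree_of c) = k * choice_sign c" if "c \<in> acyclic_choices" for c
    proof -
      have "k = f (tree_of c) * choice_sign c"
        unfolding k_def by (intro coloring_eq_choice_sign c0 that flip)
      \<comment> \<open>A sign is its own inverse, so it can be moved to the other side.\<close>
      then show ?thesis using unit[of c] by auto
    qed
    then have "(\<Sum>c\<in>acyclic_choices. f (tree_of c)) = k * (\<Sum>c\<in>acyclic_choices. choice_sign c)"
      by (simp add: sum_distrib_left)
    then have "(\<Sum>T\<in>?A. f T) = k * (\<Sum>c\<in>acyclic_choices. choice_sign c)"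
      by (simp only: sum.reindex_bij_betw[OF bij_betw_tree_of])
    moreover have "\<bar>k\<bar> = 1" using unit[of c0] by (auto simp: k_def f_def)
    ultimately show ?thesis
      using diff abs_sum_choice_sign_le_1 by (metis abs_mult mult_1)
  qed
qed

end

theorem theorem12:
  fixes G :: "('a, 'b) pre_digraph" and r :: 'a
    and X Y :: "('a, 'b) pre_digraph set"
  assumes "digraph G"
    and "r \<in> verts G"
    and "\<And>v. v \<in> verts G \<Longrightarrow> in_degree G v \<le> 2"
    and "bipartition (flip_graph G r) X Y"
  shows "\<bar>int (card X) - int (card Y)\<bar> \<le> 1"
proof -
  interpret digraph G by fact
  obtain vs where "bij_betw vs {0..<card (verts G - {r})} (verts G - {r})"
    using ex_bij_betw_nat_finite[of "verts G - {r}"] by auto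
  then interpret rooted_indegree_two_digraph G r "card (verts G - {r})" vs
    using assms(2,3) by unfold_locales
  show ?thesis using assms(4) by (rule bipartition_classes_differ_le_1)
qed

end
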